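(* Let $g:S\to F^*$ be a function such that $\mathcal{H}=\{u/g(u)\mid u\in S\}\cup\{0\}$ is a hyperoval in $K$, and let $s\in S$. Let $$\mathcal{O}_s=\left\{\frac{v}{g(v)}+\frac{s}{g(s)}\ \Big|\ v\in S,\ v\neq s\right\}\cup\left\{\frac{s}{g(s)}\right\},$$ which is an oval whose nucleus is the origin. Then the function $g_s:S\to F$ associated with $\mathcal{O}_s$ is $$g_s(u)=\sum_{i=0}^{q}a_iu^{i+1},$$ $$a_i=g(s)\,s^{(q-1)i/2-1}+g(s)\sum_{v\in S,\,v\neq s}g(v)\big(g(s)v+sg(v)\big)^{(q-1)i/2-1}.$$
   Context: $F=\mathbb{F}_{q}$ with $q=2^m$, $K=\mathbb{F}_{q^2}\supset F$, $\bar{x}=x^q$, $S=\{u\in K: u\bar u=1\}$. $K$, a two-dimensional $F$-vector space, is regarded as the point set of the affine plane $AG(2,q)$, embedded in its projective completion $PG(2,q)$; the origin is $0\in K$. An oval (resp. hyperoval) in $PG(2,q)$ is a set of $q+1$ (resp. $q+2$) points, no three collinear; all tangent lines of an oval meet in one point, its nucleus. A hyperoval (or oval) in $K$ is one all of whose points lie in $K$. The function associated with an oval $\mathcal{O}\subset K$ with nucleus the origin is the unique $\gamma:S\to F^*$ with $\mathcal{O}=\{u/\gamma(u)\mid u\in S\}$. Exponents of elements of $K^*$ are taken modulo $q^2-1$, which is odd, so $1/2$ denotes the inverse of $2$ modulo $q^2-1$; i.e. $v^{(q-1)i/2}$ is the unique square root of $v^{(q-1)i}$ in $K$. *)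

theory Defs
  imports "HOL-Library.Cardinality" "HOL-Number_Theory.Modular_Inverse"
begin

text \<open>
  Throughout, the finite field \<open>'a\<close> plays the role of \<open>K\<close>, the field with \<open>q\<^sup>2\<close> elements.
  Its subfield \<open>F\<close> with \<open>q\<close> elements consists of the fixed points of \<open>x \<mapsto> x\<^sup>q\<close>.
\<close>

definition bar :: "nat \<Rightarrow> 'a::field \<Rightarrow> 'a" where
  "bar q x = x ^ q"

definition subfield_F :: "nat \<Rightarrow> 'a::field set" where
  "subfield_F q = {x. bar q x = x}"

definition unit_circle :: "nat \<Rightarrow> 'a::field set" where
  "unit_circle q = {u. u * bar q u = 1}"

text \<open>
  The projective completion of the affine plane \<open>K\<close>: a point at infinity is a parallel class
  of affine lines, represented by the one-dimensional \<open>F\<close>-subspace of \<open>K\<close> belonging to it.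
  Only \<open>Infinite D\<close> with such a subspace \<open>D\<close> counts as a point.
\<close>

datatype 'a proj_point = Affine 'a | Infinite "'a set"

definition direction :: "nat \<Rightarrow> 'a::field \<Rightarrow> 'a set" where
  "direction q d = {t * d | t. t \<in> subfield_F q}"

definition line_at_infinity :: "nat \<Rightarrow> 'a::field proj_point set" where
  "line_at_infinity q = {Infinite (direction q d) | d. d \<noteq> 0}"

definition completed_line :: "nat \<Rightarrow> 'a::field \<Rightarrow> 'a \<Rightarrow> 'a proj_point set" where
  "completed_line q a d =
     insert (Infinite (direction q d)) {Affine (a + x) | x. x \<in> direction q d}"

definition proj_points :: "nat \<Rightarrow> 'a::field proj_point set" where
  "proj_points q = range Affine \<union> line_at_infinity q"

definition proj_lines :: "nat \<Rightarrow> 'a::field proj_point set set" where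
  "proj_lines q = insert (line_at_infinity q) {completed_line q a d | a d. d \<noteq> 0}"

definition no_three_collinear :: "nat \<Rightarrow> 'a::field proj_point set \<Rightarrow> bool" where
  "no_three_collinear q X \<longleftrightarrow>
     (\<forall>A. A \<subseteq> X \<and> card A = 3 \<longrightarrow> \<not> (\<exists>l\<in>proj_lines q. A \<subseteq> l))"

definition oval :: "nat \<Rightarrow> 'a::field proj_point set \<Rightarrow> bool" where
  "oval q X \<longleftrightarrow> X \<subseteq> proj_points q \<and> card X = q + 1 \<and> no_three_collinear q X"

definition hyperoval :: "nat \<Rightarrow> 'a::field proj_point set \<Rightarrow> bool" where
  "hyperoval q X \<longleftrightarrow> X \<subseteq> proj_points q \<and> card X = q + 2 \<and> no_three_collinear q X"

definition tangents :: "nat \<Rightarrow> 'a::field proj_point set \<Rightarrow> 'a proj_point set set" where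
  "tangents q X = {l \<in> proj_lines q. \<exists>P. l \<inter> X = {P}}"

definition is_nucleus :: "nat \<Rightarrow> 'a::field proj_point set \<Rightarrow> 'a proj_point \<Rightarrow> bool" where
  "is_nucleus q X N \<longleftrightarrow> \<Inter>(tangents q X) = {N}"

definition oval_in_K :: "nat \<Rightarrow> 'a::field set \<Rightarrow> bool" where
  "oval_in_K q X \<longleftrightarrow> oval q (Affine ` X)"

definition hyperoval_in_K :: "nat \<Rightarrow> 'a::field set \<Rightarrow> bool" where
  "hyperoval_in_K q X \<longleftrightarrow> hyperoval q (Affine ` X)"

text \<open>
  Values of \<open>\<gamma>\<close> outside \<open>unit_circle q\<close> are irrelevant, so a function associated
  with \<open>X\<close> can only be unique up to its values there.
\<close>

definition associated_function :: "nat \<Rightarrow> 'a::field set \<Rightarrow> ('a \<Rightarrow> 'a) \<Rightarrow> bool" where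
  "associated_function q X \<gamma> \<longleftrightarrow>
     \<gamma> ` unit_circle q \<subseteq> subfield_F q - {0} \<and> X = {u / \<gamma> u | u. u \<in> unit_circle q}"

definition translated_oval :: "nat \<Rightarrow> ('a::field \<Rightarrow> 'a) \<Rightarrow> 'a \<Rightarrow> 'a set" where
  "translated_oval q g s =
     {v / g v + s / g s | v. v \<in> unit_circle q \<and> v \<noteq> s} \<union> {s / g s}"

text \<open>The exponent \<open>(q-1)i/2 - 1\<close>, where \<open>1/2\<close> is the inverse of \<open>2\<close> modulo \<open>q\<^sup>2-1\<close>.\<close>

definition half_exponent :: "nat \<Rightarrow> nat \<Rightarrow> int" where
  "half_exponent q i =
     (int q - 1) * int i * modular_inverse ((int q)\<^sup>2 - 1) 2 - 1"

definition coeff_a :: "nat \<Rightarrow> ('a::field \<Rightarrow> 'a) \<Rightarrow> 'a \<Rightarrow> nat \<Rightarrow> 'a" where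
  "coeff_a q g s i =
     g s * s powi half_exponent q i
     + g s * (\<Sum>v \<in> unit_circle q - {s}. g v * (g s * v + s * g v) powi half_exponent q i)"

definition translated_function :: "nat \<Rightarrow> ('a::field \<Rightarrow> 'a) \<Rightarrow> 'a \<Rightarrow> 'a \<Rightarrow> 'a" where
  "translated_function q g s u = (\<Sum>i = 0..q. coeff_a q g s i * u ^ (i + 1))"

end

theory Submission
  imports Defs "HOL-Computational_Algebra.Polynomial"
begin

text \<open>
  Translating \<open>\<H>\<close> by one of its own points \<open>p\<close> (so \<open>p + p = 0\<close>) gives a hyperoval through the
  origin, and \<open>translated_oval\<close> is that hyperoval without the origin. A line through a point of a
  hyperoval contains exactly one further point of it: the directions are classified by the map
  \<open>d \<mapsto> d\<^sup>q\<^sup>-\<^sup>1\<close> into \<open>S\<close>, which has at most \<open>q + 1\<close> elements. Hence the tangents of the oval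
  are exactly the lines through the origin, and there is one point \<open>u / \<gamma> u\<close> in each direction
  \<open>u \<in> S\<close>. For \<open>w = u / \<gamma> u\<close> one has \<open>w\<^bsup>(q-1)i/2-1\<^esup> = \<gamma> u \<cdot> u\<^bsup>-(i+1)\<^esup>\<close>, so the
  formula is Lagrange interpolation on the group \<open>S\<close> of order \<open>q + 1\<close>, where \<open>q + 1 = 1\<close> in \<open>K\<close>.
\<close>

section \<open>Arithmetic in K, its subfield F and the group S\<close>

lemma finite_field_power_card_minus_1:
  fixes x :: "'a::{field,finite}"
  assumes "x \<noteq> 0"
  shows "x ^ (CARD('a) - 1) = 1"
proof -
  let ?P = "\<Prod>y\<in>UNIV - {0::'a}. y"
  have "?P = (\<Prod>y\<in>UNIV - {0}. x * y)"
    by (rule prod.reindex_bij_witness[of _ "\<lambda>y. x * y" "\<lambda>y. y / x"]) (use assms in auto)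
  also have "\<dots> = x ^ (CARD('a) - 1) * ?P"
    by (simp add: prod.distrib)
  finally show ?thesis
    by simp
qed

locale quadratic_extension =
  fixes q :: nat and K :: "'a::{field,finite} itself"
  assumes q_power: "\<exists>m\<ge>1. q = 2 ^ m" and card_K: "CARD('a) = q ^ 2"
begin

abbreviation F :: "'a set" where "F \<equiv> subfield_F q"
abbreviation S :: "'a set" where "S \<equiv> unit_circle q"

lemma q_gt_1: "q > 1"
  using q_power by (metis one_less_numeral_iff one_less_power semiring_norm(76) less_le_trans zero_less_one)

lemma even_q: "even q"
  using q_power by auto

lemma fermat: "x \<noteq> 0 \<Longrightarrow> (x::'a) ^ (q ^ 2 - 1) = 1"
  using finite_field_power_card_minus_1[of x] card_K by simp

text \<open>Since \<open>q ^ 2 - 1\<close> is odd, that power of \<open>-1\<close> is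
  \<open>-1\<close>, while Fermat's identity makes it \<open>1\<close>.\<close>

lemma char_2: "CHAR('a) = 2"
proof -
  have "odd (q ^ 2 - 1)"
    using even_q q_gt_1 by simp
  hence "(-1::'a) = 1"
    using fermat[of "-1"] by simp
  hence "of_nat 2 = (0::'a)"
    by (metis add.right_inverse of_nat_1 of_nat_add one_add_one)
  hence "CHAR('a) dvd 2"
    by (simp only: of_nat_eq_0_iff_char_dvd)
  thus ?thesis
    by (metis CHAR_not_1' One_nat_def prime_nat_iff two_is_prime_nat)
qed

lemma uminus_eq [simp]: "- x = (x::'a)"
  by (rule uminus_CHAR_2[OF char_2])

lemma add_self [simp]: "x + x = (0::'a)"
  using uminus_eq[of x] by (metis add.right_inverse)

lemma power_q_add: "(x + y :: 'a) ^ q = x ^ q + y ^ q"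
  using q_power freshmans_dream'[where ?'a = 'a] char_2 by auto

lemma of_nat_q: "of_nat q = (0::'a)"
  using even_q char_2 of_nat_eq_0_iff_char_dvd by metis

lemma F_iff: "x \<in> F \<longleftrightarrow> x ^ q = x"
  by (simp add: subfield_F_def bar_def)

lemma zero_in_F [simp]: "0 \<in> F" and one_in_F [simp]: "1 \<in> F"
  using q_gt_1 by (auto simp: F_iff)

lemma F_add: "x \<in> F \<Longrightarrow> y \<in> F \<Longrightarrow> x + y \<in> F"
  by (simp add: F_iff power_q_add)

lemma F_diff: "x \<in> F \<Longrightarrow> y \<in> F \<Longrightarrow> x - y \<in> F"
  using F_add[of x y] by (metis diff_conv_add_uminus uminus_eq)

lemma F_mult: "x \<in> F \<Longrightarrow> y \<in> F \<Longrightarrow> x * y \<in> F"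
  by (simp add: F_iff power_mult_distrib)

lemma F_divide: "x \<in> F \<Longrightarrow> y \<in> F \<Longrightarrow> x / y \<in> F"
  by (simp add: F_iff power_divide)

lemma F_power_pred: "x \<in> F \<Longrightarrow> x \<noteq> 0 \<Longrightarrow> x ^ (q - 1) = 1"
  using q_gt_1 power_minus_mult[of q x] by (auto simp: F_iff)

lemma F_I: "x ^ (q - 1) = 1 \<Longrightarrow> x \<in> F"
  using q_gt_1 power_minus_mult[of q x] by (auto simp: F_iff)

lemma S_iff: "u \<in> S \<longleftrightarrow> u ^ (q + 1) = 1"
  by (simp add: unit_circle_def bar_def)

lemma S_nonzero: "u \<in> S \<Longrightarrow> u \<noteq> 0"
  by (auto simp: S_iff)

lemma S_divide: "u \<in> S \<Longrightarrow> v \<in> S \<Longrightarrow> u / v \<in> S"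
  by (simp add: S_iff power_divide del: power_Suc)

lemma power_q_pred_in_S: "d \<noteq> 0 \<Longrightarrow> d ^ (q - 1) \<in> S"
proof -
  assume d: "d \<noteq> 0"
  have "(q - 1) * (q + 1) = q ^ 2 - 1"
    by (simp add: power2_eq_square algebra_simps)
  thus ?thesis
    using fermat[OF d] by (simp only: S_iff flip: power_mult)
qed

text \<open>Elements of \<open>S\<close> are roots of a polynomial of degree \<open>q + 1\<close>.
  Equality comes later, from the directions of a hyperoval.\<close>

lemma card_S_le: "card S \<le> q + 1"
proof -
  define p :: "'a poly" where "p = monom 1 (q + 1) - 1"
  have deg: "degree p = q + 1"
    unfolding p_def diff_conv_add_uminus
    by (subst degree_add_eq_left) (auto simp: degree_monom_eq simp del: uminus_eq)
  have "S = {x. poly p x = 0}"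
    by (auto simp: p_def S_iff poly_monom simp del: power_Suc)
  also have "card \<dots> \<le> degree p"
    using deg by (intro card_poly_roots_bound) auto
  finally show ?thesis
    by (simp add: deg)
qed

text \<open>The two conditions give \<open>x * x = 1\<close>, which in characteristic 2 has the
  double root 1.\<close>

lemma S_inter_F: "x \<in> S \<Longrightarrow> x \<in> F \<Longrightarrow> x = 1"
proof -
  assume "x \<in> S" "x \<in> F"
  hence "(x + 1) * (x + 1) = 0"
    by (simp add: S_iff F_iff algebra_simps)
  thus "x = 1"
    by (simp add: add_eq_0_iff)
qed

text \<open>If two values agree, \<open>u / v\<close> lies in both \<open>S\<close> and
  \<open>F\<close>, hence is 1.\<close>

lemma inj_on_S_divide:
  assumes "g ` S \<subseteq> F - {0}"
  shows "inj_on (\<lambda>u. u / g u) S"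
proof (rule inj_onI)
  fix u v
  assume uv: "u \<in> S" "v \<in> S" "u / g u = v / g v"
  hence g: "g u \<in> F" "g v \<in> F" "g u \<noteq> 0" "g v \<noteq> 0"
    using assms by auto
  hence "u / v = g u / g v"
    using uv S_nonzero by (simp add: field_simps)
  hence "u / v = 1"
    using S_inter_F[OF S_divide] F_divide uv g by metis
  thus "u = v"
    using S_nonzero[OF uv(2)] by simp
qed

section \<open>Arcs of affine points\<close>

definition arc :: "'a set \<Rightarrow> bool" where
  "arc X \<longleftrightarrow> (\<forall>x\<in>X. \<forall>y\<in>X. \<forall>z\<in>X.
     x \<noteq> y \<longrightarrow> x \<noteq> z \<longrightarrow> y \<noteq> z \<longrightarrow> (z - x) / (y - x) \<notin> F)"

lemma arcD:
  "arc X \<Longrightarrow> x \<in> X \<Longrightarrow> y \<in> X \<Longrightarrow> z \<in> X \<Longrightarrow> x \<noteq> y \<Longrightarrow> x \<noteq> z \<Longrightarrow> y \<noteq> z \<Longrightarrow>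
    (z - x) / (y - x) \<notin> F"
  unfolding arc_def by meson

lemma mem_direction_iff: "d \<noteq> 0 \<Longrightarrow> x \<in> direction q d \<longleftrightarrow> x / d \<in> F"
  by (auto simp: direction_def intro!: exI[of _ "x / d"])

lemma Affine_mem_completed_line_iff:
  "d \<noteq> 0 \<Longrightarrow> Affine x \<in> completed_line q a d \<longleftrightarrow> (x - a) / d \<in> F"
  by (auto simp: completed_line_def mem_direction_iff intro!: exI[of _ "x - a"])

text \<open>The quotient in \<open>arc\<close> is the coordinate of \<open>z\<close> on the line
  through \<open>x\<close> and \<open>y\<close>, so lying in \<open>F\<close> means collinearity.
  Later counting can then ignore lines and points at infinity.\<close>

lemma no_three_collinear_iff_arc: "no_three_collinear q (Affine ` X) \<longleftrightarrow> arc X"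
proof
  assume no: "no_three_collinear q (Affine ` X)"
  show "arc X"
    unfolding arc_def
  proof (intro ballI impI notI)
    fix x y z
    assume xyz: "x \<in> X" "y \<in> X" "z \<in> X" "x \<noteq> y" "x \<noteq> z" "y \<noteq> z"
      and F: "(z - x) / (y - x) \<in> F"
    have "y - x \<noteq> 0"
      using xyz by simp
    with F have "{Affine x, Affine y, Affine z} \<subseteq> completed_line q x (y - x)"
      by (simp add: Affine_mem_completed_line_iff)
    moreover have "completed_line q x (y - x) \<in> proj_lines q"
      unfolding proj_lines_def
      by (rule insertI2, rule CollectI, rule exI[of _ x], rule exI[of _ "y - x"]) (use xyz in simp)
    moreover have "card {Affine x, Affine y, Affine z} = 3"
      using xyz by simp
    moreover have "{Affine x, Affine y, Affine z} \<subseteq> Affine ` X"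
      using xyz by simp
    ultimately show False
      using no unfolding no_three_collinear_def by metis
  qed
next
  assume arc: "arc X"
  show "no_three_collinear q (Affine ` X)"
    unfolding no_three_collinear_def
  proof (intro allI impI notI)
    fix A
    assume A: "A \<subseteq> Affine ` X \<and> card A = 3" and ex: "\<exists>l\<in>proj_lines q. A \<subseteq> l"
    then obtain P Q R where A3: "A = {P, Q, R}" "P \<noteq> Q" "P \<noteq> R" "Q \<noteq> R"
      by (meson card_3_iff)
    with A obtain x y z where xyz: "P = Affine x" "Q = Affine y" "R = Affine z"
      "x \<in> X" "y \<in> X" "z \<in> X"
      by auto
    from ex obtain l where l: "l \<in> proj_lines q" "A \<subseteq> l"
      by blast
    have "l \<noteq> line_at_infinity q"
      using l(2) unfolding A3 xyz by (auto simp: line_at_infinity_def)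
    then obtain a d where "d \<noteq> 0" "l = completed_line q a d"
      using l(1) unfolding proj_lines_def by blast
    moreover have "Affine x \<in> l" "Affine y \<in> l" "Affine z \<in> l"
      using l(2) unfolding A3 xyz by auto
    ultimately have F: "(x - a) / d \<in> F" "(y - a) / d \<in> F" "(z - a) / d \<in> F"
      by (simp_all add: Affine_mem_completed_line_iff)
    \<comment> \<open>The three points have coordinates in \<open>F\<close> along the line; in the
      ratio of their differences both \<open>a\<close> and \<open>d\<close> cancel.\<close>
    have "((z - a) / d - (x - a) / d) / ((y - a) / d - (x - a) / d) \<in> F"
      by (rule F_divide[OF F_diff[OF F(3,1)] F_diff[OF F(2,1)]])
    moreover have "(b - a) / d - (x - a) / d = (b - x) / d" for b
      by (simp only: diff_divide_distrib[symmetric] diff_diff_eq2 diff_add_cancel)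
    ultimately have "(z - x) / (y - x) \<in> F"
      using \<open>d \<noteq> 0\<close> by simp
    thus False
      using arcD[OF arc, of x y z] A3 xyz by auto
  qed
qed

lemma arc_translate: "arc X \<Longrightarrow> arc ((\<lambda>x. x + a) ` X)"
  unfolding arc_def by simp

lemma arc_mono: "arc X \<Longrightarrow> Y \<subseteq> X \<Longrightarrow> arc Y"
  unfolding arc_def by (meson subsetD)

section \<open>Directions seen from a point of a hyperoval\<close>

lemma
  assumes "arc X" "card X = q + 2" "P \<in> X"
  shows arc_directions: "(\<lambda>x. (x - P) ^ (q - 1)) ` (X - {P}) = S"
    and arc_imp_card_S: "card S = q + 1"
proof -
  let ?f = "\<lambda>x. (x - P) ^ (q - 1)"
  \<comment> \<open>Equal values of \<open>?f\<close> put the ratio of the two chords from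
    \<open>P\<close> in \<open>F\<close>, so both points would be collinear with
    \<open>P\<close>.\<close>
  have "inj_on ?f (X - {P})"
  proof (rule inj_onI, rule ccontr)
    fix x y
    assume xy: "x \<in> X - {P}" "y \<in> X - {P}" "?f x = ?f y" "x \<noteq> y"
    hence "((x - P) / (y - P)) ^ (q - 1) = 1"
      by (simp add: power_divide)
    hence "(x - P) / (y - P) \<in> F"
      by (rule F_I)
    thus False
      using arcD[OF assms(1,3), of y x] xy by auto
  qed
  hence card: "card (?f ` (X - {P})) = q + 1"
    using assms by (simp add: card_image)
  moreover have "?f ` (X - {P}) \<subseteq> S"
    by (intro image_subsetI power_q_pred_in_S) auto
  \<comment> \<open>Pigeonhole: \<open>q + 1\<close> distinct values fill a set of at most
    \<open>q + 1\<close> elements, which also settles the order of \<open>S\<close>.\<close>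
  ultimately show "?f ` (X - {P}) = S"
    using card_S_le by (intro card_seteq) auto
  with card show "card S = q + 1"
    by simp
qed

text \<open>Surjectivity of the direction map: a hyperoval has no tangent at any of its
  points.\<close>

lemma arc_meets_every_line:
  assumes "arc X" "card X = q + 2" "P \<in> X" "d \<noteq> 0"
  shows "\<exists>x\<in>X. x \<noteq> P \<and> (x - P) / d \<in> F"
proof -
  obtain x where x: "x \<in> X" "x \<noteq> P" "d ^ (q - 1) = (x - P) ^ (q - 1)"
    using power_q_pred_in_S[OF assms(4)] arc_directions[OF assms(1-3)] by blast
  hence "((x - P) / d) ^ (q - 1) = 1"
    using assms(4) by (simp add: power_divide)
  thus ?thesis
    using x F_I by blast
qed

lemma self_in_direction: "(d::'a) \<noteq> 0 \<Longrightarrow> d \<in> direction q d"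
  by (simp add: mem_direction_iff)

section \<open>A hyperoval with its point 0 removed\<close>

context
  fixes X :: "'a set"
  assumes arc_X: "arc (insert 0 X)" and card_X: "card X = q + 1" and zero_notin: "0 \<notin> X"
begin

lemma card_insert_0: "card (insert 0 X) = q + 2"
  using card_X zero_notin by simp

text \<open>Two points in one direction would be collinear with 0, a third point of the
  hyperoval.\<close>

lemma arc_same_direction:
  assumes "x \<in> X" "y \<in> X" "y / x \<in> F"
  shows "x = y"
proof (rule ccontr)
  assume "x \<noteq> y"
  moreover have "x \<noteq> 0" "y \<noteq> 0"
    using assms zero_notin by auto
  ultimately have "(y - 0) / (x - 0) \<notin> F"
    using arcD[OF arc_X, of 0 x y] assms \<open>x \<noteq> y\<close> by auto
  thus False
    using assms by simp
qed

lemma arc_oval: "oval_in_K q X"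
  using arc_mono[OF arc_X, of X] card_X
  by (auto simp: oval_in_K_def oval_def no_three_collinear_iff_arc card_image inj_on_def proj_points_def)

lemma arc_meets_direction:
  assumes "d \<noteq> 0"
  shows "\<exists>x\<in>X. x / d \<in> F"
  using arc_meets_every_line[OF arc_X card_insert_0 insertI1 assms] by auto

text \<open>A tangent of \<open>X\<close> must meet the hyperoval \<open>insert 0 X\<close> a second
  time, and only 0 is left for that. Conversely, each line through 0 carries exactly one point of
  \<open>X\<close>.\<close>

lemma arc_tangents: "tangents q (Affine ` X) = {completed_line q 0 d | d. d \<noteq> 0}"
proof (intro equalityI subsetI)
  fix l
  assume "l \<in> tangents q (Affine ` X)"
  then obtain P where l: "l \<in> proj_lines q" and P: "l \<inter> Affine ` X = {P}"
    unfolding tangents_def by blast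
  have "P \<in> l" "P \<in> Affine ` X"
    using P by (metis Int_iff singletonI)+
  then obtain x where x: "P = Affine x" "x \<in> X" "Affine x \<in> l"
    by (elim imageE) simp
  hence "l \<noteq> line_at_infinity q"
    by (auto simp: line_at_infinity_def)
  then obtain a d where d: "d \<noteq> 0" and l_eq: "l = completed_line q a d"
    using l unfolding proj_lines_def by blast
  have xF: "(x - a) / d \<in> F"
    using x d by (simp add: l_eq Affine_mem_completed_line_iff)
  obtain y where y: "y \<in> insert 0 X" "y \<noteq> x" "(y - x) / d \<in> F"
    using arc_meets_every_line[OF arc_X card_insert_0 _ d] x by blast
  have "(y - a) / d \<in> F"
  proof -
    have "(x - a) + (y - x) = y - a"
      by algebra
    thus ?thesis
      using F_add[OF xF y(3)] by (simp only: add_divide_distrib[symmetric])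
  qed
  hence "Affine y \<in> l"
    using d by (simp add: l_eq Affine_mem_completed_line_iff)
  hence "y \<in> X \<Longrightarrow> Affine y \<in> l \<inter> Affine ` X"
    by simp
  hence "y = 0"
    using y(1,2) unfolding P x(1) by auto
  hence aF: "a / d \<in> F"
    using \<open>(y - a) / d \<in> F\<close> by simp
  have shift: "a + z \<in> direction q d" if "z \<in> direction q d" for z
    using F_add[OF aF, of "z / d"] that d by (simp add: mem_direction_iff add_divide_distrib)
  \<comment> \<open>Adding \<open>a\<close> is an involution, so \<open>shift\<close> yields both
    inclusions between the affine parts.\<close>
  have "z = a + (a + z)" for z
    by (simp only: add.assoc[symmetric] add_self add_0)
  with shift have eq: "{Affine (a + z) | z. z \<in> direction q d} = {Affine (0 + z) | z. z \<in> direction q d}"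
    unfolding add_0 by blast
  have "l = completed_line q 0 d"
    unfolding l_eq completed_line_def eq ..
  thus "l \<in> {completed_line q 0 d | d. d \<noteq> 0}"
    using d by blast
next
  fix l
  assume "l \<in> {completed_line q (0::'a) d | d. d \<noteq> 0}"
  then obtain d where d: "d \<noteq> 0" and l: "l = completed_line q 0 d"
    by blast
  obtain x where x: "x \<in> X" "x / d \<in> F"
    using arc_meets_direction[OF d] by blast
  have unique: "y = x" if "y \<in> X" "y / d \<in> F" for y
    using arc_same_direction[OF that(1) x(1)] F_divide[OF x(2) that(2)] d by simp
  have mem: "Affine y \<in> l \<longleftrightarrow> y / d \<in> F" for y
    using d by (simp add: l Affine_mem_completed_line_iff)
  have "l \<inter> Affine ` X = {Affine x}"
    using x unique mem by blast
  moreover have "l \<in> proj_lines q"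
    using d unfolding l proj_lines_def by blast
  ultimately show "l \<in> tangents q (Affine ` X)"
    by (auto simp: tangents_def)
qed

text \<open>Two points of \<open>X\<close> lie in different directions, so the tangents through them
  already share only 0 and have no common point at infinity.\<close>

lemma arc_nucleus: "is_nucleus q (Affine ` X) (Affine 0)"
proof -
  have "finite X" "2 \<le> card X"
    using card_X q_gt_1 by (auto intro: finite)
  then obtain x y where xy: "x \<in> X" "y \<in> X" "x \<noteq> y"
    by (metis card_2_iff' obtain_subset_with_card_n subsetD)
  have nz: "x \<noteq> 0" "y \<noteq> 0"
    using xy zero_notin by auto
  have notF: "y / x \<notin> F"
    using arc_same_direction xy by blast
  have "N = Affine 0" if "N \<in> completed_line q 0 x" "N \<in> completed_line q 0 y" for N
  proof (cases N)
    case (Affine z)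
    hence "z / x \<in> F" "z / y \<in> F"
      using that nz by (auto simp: Affine_mem_completed_line_iff)
    hence "z \<noteq> 0 \<Longrightarrow> y / x \<in> F"
      using F_divide[of "z / x" "z / y"] nz by simp
    thus ?thesis
      using notF Affine by auto
  next
    case (Infinite D)
    hence "direction q x = direction q y"
      using that by (auto simp: completed_line_def)
    hence "y \<in> direction q x"
      using self_in_direction nz by blast
    thus ?thesis
      using notF nz by (simp add: mem_direction_iff)
  qed
  hence "\<Inter>(tangents q (Affine ` X)) \<subseteq> {Affine 0}"
    using nz unfolding arc_tangents by blast
  moreover have "Affine 0 \<in> \<Inter>(tangents q (Affine ` X))"
    by (auto simp: arc_tangents Affine_mem_completed_line_iff)
  ultimately show ?thesis
    by (auto simp: is_nucleus_def)
qed

text \<open>If \<open>x\<close> is the point of \<open>X\<close> in direction \<open>u\<close>, the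
  value at \<open>u\<close> has to be \<open>u / x\<close>. Injectivity and equal cardinality make
  the parametrisation onto.\<close>

lemma arc_associated_function_exists: "\<exists>\<gamma>. associated_function q X \<gamma>"
proof -
  have "\<exists>c. c \<in> F - {0} \<and> u / c \<in> X" if u: "u \<in> S" for u
  proof -
    obtain x where x: "x \<in> X" "x / u \<in> F"
      using arc_meets_direction[OF S_nonzero[OF u]] by blast
    have "x \<noteq> 0"
      using x zero_notin by auto
    moreover have "u / x \<in> F"
      using F_divide[OF one_in_F x(2)] by simp
    ultimately show ?thesis
      using x S_nonzero[OF u] by (intro exI[of _ "u / x"]) auto
  qed
  then obtain \<gamma> where \<gamma>: "\<And>u. u \<in> S \<Longrightarrow> \<gamma> u \<in> F - {0} \<and> u / \<gamma> u \<in> X"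
    by metis
  have "inj_on (\<lambda>u. u / \<gamma> u) S"
    using \<gamma> by (intro inj_on_S_divide) auto
  hence "card ((\<lambda>u. u / \<gamma> u) ` S) = card X"
    using arc_imp_card_S[OF arc_X card_insert_0 insertI1] card_X by (simp add: card_image)
  hence "(\<lambda>u. u / \<gamma> u) ` S = X"
    using \<gamma> by (intro card_subset_eq) auto
  thus ?thesis
    using \<gamma> by (intro exI[of _ \<gamma>]) (auto simp: associated_function_def)
qed

end

section \<open>Interpolation on S and the half exponent\<close>

lemma sum_powers_S:
  assumes "z \<in> S"
  shows "(\<Sum>i=0..q. z ^ (i + 1)) = (if z = 1 then 1 else 0)"
proof (cases "z = 1")
  case True
  \<comment> \<open>There are \<open>q + 1\<close> summands equal to 1, and \<open>q\<close>
    vanishes in K.\<close>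
  thus ?thesis
    by (simp add: of_nat_q)
next
  case False
  \<comment> \<open>Pulling one factor \<open>z\<close> out of the sum leaves this geometric series,
    which \<open>z ^ (q + 1) = 1\<close> annihilates.\<close>
  have "(\<Sum>i<q + 1. z ^ i) = 0"
    using False assms geometric_sum[of z "q + 1"] by (simp add: S_iff del: power_Suc)
  moreover have "{0..q} = {..<q + 1}"
    by auto
  ultimately show ?thesis
    using False by (simp flip: sum_distrib_left)
qed

text \<open>As \<open>c ^ (q - 1) = 1\<close>, only the summand \<open>-1\<close> of the exponent
  survives.\<close>

lemma powi_half_exponent_F:
  assumes "c \<in> F" "c \<noteq> 0"
  shows "c powi half_exponent q i = inverse c"
proof -
  have "c powi (int q - 1) = 1"
    using assms F_power_pred[of c] q_gt_1
    by (metis less_imp_le_nat of_nat_1 of_nat_diff power_int_of_nat)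
  thus ?thesis
    using assms by (simp add: half_exponent_def power_int_diff power_int_mult mult.assoc divide_inverse)
qed

lemma divide_F_powi_half_exponent:
  assumes "c \<in> F" "c \<noteq> 0"
  shows "(x / c) powi half_exponent q i = c * x powi half_exponent q i"
  unfolding power_int_divide_distrib powi_half_exponent_F[OF assms] by (simp add: divide_inverse)

text \<open>Exponents of \<open>u\<close> count modulo \<open>q + 1\<close>. There
  \<open>q - 1\<close> is \<open>-2\<close>, its half is \<open>-1\<close>, and the whole exponent
  becomes \<open>-(i + 1)\<close>.\<close>

lemma powi_half_exponent_S:
  assumes "u \<in> S"
  shows "u powi half_exponent q i = inverse u ^ (i + 1)"
proof -
  define h where "h = modular_inverse ((int q)\<^sup>2 - 1) 2"
  have "coprime (2::int) ((int q)\<^sup>2 - 1)"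
    using even_q by simp
  hence "[2 * h = 1] (mod ((int q)\<^sup>2 - 1))"
    unfolding h_def by (rule cong_modular_inverse1)
  then obtain k where k: "2 * h - 1 = ((int q)\<^sup>2 - 1) * k"
    by (auto simp: cong_iff_dvd_diff)
  \<comment> \<open>Here \<open>2 * h - 1\<close> is a multiple of \<open>q ^ 2 - 1\<close>, hence
    of \<open>q + 1\<close>; this makes \<open>(q - 1) * h\<close> congruent to
    \<open>-1\<close>.\<close>
  have "(int q - 1) * h + 1 = (int q + 1) * h - (2 * h - 1)"
    by (simp add: algebra_simps)
  also have "\<dots> = (int q + 1) * (h - (int q - 1) * k)"
    unfolding k by (simp add: algebra_simps power2_eq_square)
  finally have "(int q - 1) * h = (int q + 1) * (h - (int q - 1) * k) - 1"
    by simp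
  hence "(int q - 1) * int i * h = (int q + 1) * (h - (int q - 1) * k) * int i - int i"
    by (metis (no_types, lifting) left_diff_distrib mult.assoc mult.commute mult_1)
  hence e: "half_exponent q i = (int q + 1) * ((h - (int q - 1) * k) * int i) - int (i + 1)"
    by (simp add: half_exponent_def h_def)
  have "u powi (int q + 1) = 1"
    using assms by (metis S_iff of_nat_1 of_nat_add power_int_of_nat)
  thus ?thesis
    unfolding e using S_nonzero[OF assms]
    by (simp add: power_int_diff power_int_mult power_inverse divide_inverse del: of_nat_add of_nat_Suc power_Suc)
qed

text \<open>Orthogonality of powers on \<open>S\<close> isolates the term \<open>v = u\<close>. As
  \<open>\<gamma>\<close> is any function associated with \<open>X\<close>, this gives uniqueness on
  \<open>S\<close> along with the formula.\<close>

lemma associated_function_eq: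
  assumes "associated_function q X \<gamma>" "u \<in> S"
  shows "\<gamma> u = (\<Sum>i=0..q. (\<Sum>w\<in>X. w powi half_exponent q i) * u ^ (i + 1))"
proof -
  have \<gamma>: "\<gamma> ` S \<subseteq> F - {0}" and X: "X = (\<lambda>v. v / \<gamma> v) ` S"
    using assms(1) by (auto simp: associated_function_def)
  have powi: "(v / \<gamma> v) powi half_exponent q i = \<gamma> v * inverse v ^ (i + 1)" if "v \<in> S" for v i
    unfolding powi_half_exponent_S[OF that, symmetric]
    by (rule divide_F_powi_half_exponent) (use \<gamma> that in auto)
  have "(\<Sum>w\<in>X. w powi half_exponent q i) = (\<Sum>v\<in>S. \<gamma> v * inverse v ^ (i + 1))" for i
    unfolding X using powi by (subst sum.reindex[OF inj_on_S_divide[OF \<gamma>]]) simp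
  hence "(\<Sum>i=0..q. (\<Sum>w\<in>X. w powi half_exponent q i) * u ^ (i + 1)) =
      (\<Sum>i=0..q. \<Sum>v\<in>S. \<gamma> v * (u / v) ^ (i + 1))"
    by (simp add: sum_distrib_left sum_distrib_right power_inverse divide_inverse power_mult_distrib mult_ac)
  also have "\<dots> = (\<Sum>v\<in>S. \<gamma> v * (\<Sum>i=0..q. (u / v) ^ (i + 1)))"
    by (subst sum.swap) (simp only: sum_distrib_left)
  also have "\<dots> = (\<Sum>v\<in>S. if v = u then \<gamma> v else 0)"
  proof (rule sum.cong[OF refl])
    fix v assume v: "v \<in> S"
    show "\<gamma> v * (\<Sum>i=0..q. (u / v) ^ (i + 1)) = (if v = u then \<gamma> v else 0)"
      unfolding sum_powers_S[OF S_divide[OF assms(2) v]] using S_nonzero[OF v] by auto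
  qed
  also have "\<dots> = \<gamma> u"
    using assms(2) by simp
  finally show ?thesis ..
qed

section \<open>The translated oval and its coefficients\<close>

lemma translated_function_eq:
  assumes g: "g ` S \<subseteq> F - {0}" and s: "s \<in> S"
  shows "translated_function q g s u =
    (\<Sum>i=0..q. (\<Sum>w\<in>translated_oval q g s. w powi half_exponent q i) * u ^ (i + 1))"
proof -
  let ?e = "half_exponent q" and ?h = "\<lambda>v. v / g v + s / g s"
  have gF: "g v \<in> F" "g v \<noteq> 0" if "v \<in> S" for v
    using g that by auto
  have inj: "inj_on ?h (S - {s})"
    using inj_on_S_divide[OF g] by (auto simp: inj_on_def)
  \<comment> \<open>Equality would force \<open>v / g v = 0\<close>.\<close>
  have s_notin: "s / g s \<notin> ?h ` (S - {s})"
    using gF S_nonzero by auto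
  have X: "translated_oval q g s = insert (s / g s) (?h ` (S - {s}))"
    by (auto simp: translated_oval_def)
  have "?h v powi ?e i = g s * (g v * (g s * v + s * g v) powi ?e i)" if v: "v \<in> S" for v i
  proof -
    \<comment> \<open>The common denominator is a nonzero element of \<open>F\<close>, so it leaves
      the power as the factor \<open>g s * g v\<close> seen in \<open>coeff_a\<close>.\<close>
    have "?h v = (g s * v + s * g v) / (g s * g v)"
      using gF[OF v] gF[OF s] by (simp add: field_simps)
    thus ?thesis
      using divide_F_powi_half_exponent[of "g s * g v"] gF[OF v] gF[OF s] by (simp add: F_mult mult.assoc)
  qed
  hence "(\<Sum>w\<in>translated_oval q g s. w powi ?e i) = coeff_a q g s i" for i
    unfolding X using s_notin divide_F_powi_half_exponent[OF gF[OF s], of s i]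
    by (simp add: sum.reindex[OF inj] coeff_a_def sum_distrib_left)
  thus ?thesis
    by (simp add: translated_function_def)
qed

text \<open>In characteristic 2 the translation exchanges 0 and \<open>s / g s\<close>, so the point
  lost at \<open>v = s\<close> reappears as 0.\<close>

lemma insert_0_translated_oval:
  assumes "s \<in> S"
  shows "insert 0 (translated_oval q g s) = (\<lambda>x. x + s / g s) ` ({u / g u | u. u \<in> S} \<union> {0})"
proof -
  have "{u / g u | u. u \<in> S} = insert (s / g s) ((\<lambda>u. u / g u) ` (S - {s}))"
    using assms by auto
  thus ?thesis
    by (auto simp: translated_oval_def image_image)
qed

lemma zero_notin_translated_oval:
  assumes g: "g ` S \<subseteq> F - {0}" and s: "s \<in> S"
  shows "0 \<notin> translated_oval q g s"
proof
  assume "0 \<in> translated_oval q g s"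
  moreover have "s / g s \<noteq> 0"
    using g s S_nonzero by auto
  ultimately obtain v where v: "v \<in> S" "v \<noteq> s" "v / g v + s / g s = 0"
    by (auto simp: translated_oval_def)
  hence "v / g v = s / g s"
    by (simp only: add_eq_0_iff uminus_eq)
  thus False
    using inj_on_S_divide[OF g] v s by (auto dest: inj_onD)
qed

end

theorem theorem3p7:
  fixes m q :: nat and g :: "'a::{field,finite} \<Rightarrow> 'a" and s :: 'a
  assumes "m \<ge> 1" and "q = 2 ^ m" and "CARD('a) = q ^ 2"
    and "g ` unit_circle q \<subseteq> subfield_F q - {0}"
    and "hyperoval_in_K q ({u / g u | u. u \<in> unit_circle q} \<union> {0})"
    and "s \<in> unit_circle q"
  shows "oval_in_K q (translated_oval q g s)
    \<and> is_nucleus q (Affine ` translated_oval q g s) (Affine 0)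
    \<and> associated_function q (translated_oval q g s) (translated_function q g s)
    \<and> (\<forall>\<gamma>. associated_function q (translated_oval q g s) \<gamma> \<longrightarrow>
          (\<forall>u \<in> unit_circle q. \<gamma> u = translated_function q g s u))"
proof -
  interpret quadratic_extension q "TYPE('a)"
    using assms by unfold_locales auto
  let ?H = "{u / g u | u. u \<in> S} \<union> {0}" and ?X = "translated_oval q g s"
  have H: "arc ?H" "card ?H = q + 2"
    using assms(5) by (auto simp: hyperoval_in_K_def hyperoval_def no_three_collinear_iff_arc
        card_image inj_on_def simp del: Un_insert_right)
  have arc: "arc (insert 0 ?X)"
    unfolding insert_0_translated_oval[OF assms(6)] by (rule arc_translate[OF H(1)])
  have zero: "0 \<notin> ?X"
    by (rule zero_notin_translated_oval[OF assms(4,6)])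
  have "card (insert 0 ?X) = q + 2"
    unfolding insert_0_translated_oval[OF assms(6)] H(2)[symmetric]
    by (rule card_image) (simp add: inj_on_def)
  hence card: "card ?X = q + 1"
    using zero by simp
  have formula: "\<gamma> u = translated_function q g s u"
    if "associated_function q ?X \<gamma>" "u \<in> S" for \<gamma> u
    unfolding translated_function_eq[OF assms(4,6)] by (rule associated_function_eq[OF that])
  obtain \<gamma> where \<gamma>: "associated_function q ?X \<gamma>"
    using arc_associated_function_exists[OF arc card zero] by blast
  \<comment> \<open>By \<open>formula\<close> the polynomial agrees with \<open>\<gamma>\<close> on
    \<open>S\<close>, the only place where \<open>associated_function\<close> evaluates it.\<close>
  have "associated_function q ?X (translated_function q g s)"
    using \<gamma> formula[OF \<gamma>] unfolding associated_function_def by (auto simp: image_subset_iff) metis+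
  thus ?thesis
    using arc_oval[OF arc card zero] arc_nucleus[OF arc card zero] formula by blast
qed

end
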